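(* Let $m>0$ be a real number and let $f(x)=x^m$ for all positive integers $x$. Let $S=\{x_1,x_2,\dots,x_n\}$ be a set of $n$ distinct positive integers. (a) For any such set $S$, $i_{+}((S)_f)=n$ and $i_{-}((S)_f)=i_{0}((S)_f)=0$. (b) If $S$ is factor-closed, then $i_{+}([S]_f)$ is the number of $x_i\in S$ such that $\omega(x_i)$ is even, $i_{-}([S]_f)$ is the number of $x_i\in S$ such that $\omega(x_i)$ is odd, and $i_{0}([S]_f)=0$.
   Context: For a set $S=\{x_1,\dots,x_n\}$ of distinct positive integers and a function $f$ on the positive integers, $(S)_f$ is the $n\times n$ matrix with $ij$ entry $f(\gcd(x_i,x_j))$ (the GCD matrix), and $[S]_f$ is the $n\times n$ matrix with $ij$ entry $f(\operatorname{lcm}(x_i,x_j))$ (the LCM matrix). $S$ is factor-closed if every positive divisor of every element of $S$ belongs to $S$. For a Hermitian matrix $H$, $i_{+}(H)$, $i_{-}(H)$, $i_0(H)$ denote the numbers of positive, negative and zero eigenvalues of $H$, respectively, counted with multiplicity. $\omega(x)$ is the number of distinct prime factors of $x$, with $\omega(1)=0$. *)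

theory Defs
  imports
    "HOL-Computational_Algebra.Primes"
    "Jordan_Normal_Form.Char_Poly"
begin

text \<open>A set \<open>S = {x\<^sub>1, \<dots>, x\<^sub>n}\<close> of \<open>n\<close> distinct positive integers is given by a distinct list
  of positive naturals of length \<open>n\<close>; the order of the list fixes the order of rows and columns.\<close>

definition gcd_matrix :: "(nat \<Rightarrow> 'a) \<Rightarrow> nat list \<Rightarrow> 'a mat" where
  "gcd_matrix f xs = mat (length xs) (length xs) (\<lambda>(i, j). f (gcd (xs ! i) (xs ! j)))"

definition lcm_matrix :: "(nat \<Rightarrow> 'a) \<Rightarrow> nat list \<Rightarrow> 'a mat" where
  "lcm_matrix f xs = mat (length xs) (length xs) (\<lambda>(i, j). f (lcm (xs ! i) (xs ! j)))"

definition factor_closed :: "nat set \<Rightarrow> bool" where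
  "factor_closed S \<longleftrightarrow> (\<forall>x\<in>S. \<forall>d>0. d dvd x \<longrightarrow> d \<in> S)"

definition omega :: "nat \<Rightarrow> nat" where
  "omega x = card (prime_factors x)"

text \<open>The inertia of a Hermitian matrix. All its eigenvalues are real, so it suffices to count the
  real ones, each with its multiplicity as a root of the characteristic polynomial. The definitions
  are meaningful only for Hermitian arguments.\<close>

definition i_pos :: "complex mat \<Rightarrow> nat" where
  "i_pos H = (\<Sum>t\<in>{t::real. eigenvalue H (complex_of_real t) \<and> t > 0}.
     order (complex_of_real t) (char_poly H))"

definition i_neg :: "complex mat \<Rightarrow> nat" where
  "i_neg H = (\<Sum>t\<in>{t::real. eigenvalue H (complex_of_real t) \<and> t < 0}.
     order (complex_of_real t) (char_poly H))"

definition i_zero :: "complex mat \<Rightarrow> nat" where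
  "i_zero H = (\<Sum>t\<in>{t::real. eigenvalue H (complex_of_real t) \<and> t = 0}.
     order (complex_of_real t) (char_poly H))"

end

theory Submission
  imports Defs "Jordan_Normal_Form.Schur_Decomposition"
begin

text \<open>
  Both matrices are weighted sums of squares indexed by divisors. For a real exponent \<open>s\<close>, let \<open>J\<^sub>s\<close> be
  the arithmetic function whose sum over the divisors of \<open>n\<close> is \<open>n\<^sup>s\<close>
  (\<open>sum_jordan_totient_divisors\<close>). Then \<open>gcd(x, y)\<^sup>s\<close> is the sum of \<open>J\<^sub>s(k) [k | x] [k | y]\<close>
  (with Iverson brackets) over all \<open>k\<close>, so a matrix with entries \<open>w(x\<^sub>i) w(x\<^sub>j) gcd(x\<^sub>i, x\<^sub>j)\<^sup>s\<close> represents the Hermitian form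

  \<open>\<Sum>\<^sub>k J\<^sub>s(k) |\<ell>\<^sub>k(v)|\<^sup>2\<close>,  where  \<open>\<ell>\<^sub>k(v)\<close> is the sum of \<open>w(x\<^sub>i) v\<^sub>i\<close> over all \<open>i\<close> with \<open>k | x\<^sub>i\<close>,

  and \<open>k\<close> runs through any finite factor-closed set \<open>K\<close> that contains \<open>S\<close>. The power GCD matrix is the
  case \<open>w = 1\<close>, \<open>s = m\<close>. As \<open>lcm(x, y) gcd(x, y) = x y\<close>, the power LCM matrix is the case
  \<open>w(x) = x\<^sup>m\<close>, \<open>s = -m\<close>.

  The inertia follows from the signs of the weights by the argument behind Sylvester's law
  (\<open>inertia_of_weighted_sum_of_squares\<close>). If the \<open>\<ell>\<^sub>k\<close> have no common zero except \<open>0\<close> and no weight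
  vanishes, then \<open>i\<^sub>+ + i\<^sub>0\<close> is at most the number of positive weights, and \<open>i\<^sub>- + i\<^sub>0\<close> at most the
  number of negative ones, while \<open>i\<^sub>+ + i\<^sub>- + i\<^sub>0 = n\<close>. The \<open>\<ell>\<^sub>k\<close> with \<open>k \<in> S\<close> already separate
  vectors, since divisibility is triangular on \<open>S\<close> (\<open>divisor_incidence_injective\<close>).

  It remains to read off signs from \<open>J\<^sub>s(n) = n\<^sup>s \<Prod> (1 - p\<^sup>-\<^sup>s)\<close>, the product being over the primes
  \<open>p\<close> that divide \<open>n\<close>. For \<open>s = m > 0\<close> every factor is positive, hence \<open>i\<^sub>- + i\<^sub>0 \<le> 0\<close> for the GCD
  matrix; here \<open>K\<close> consists of all divisors of elements of \<open>S\<close>. For \<open>s = -m < 0\<close> each of the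
  \<open>\<omega>(n)\<close> factors is negative, so \<open>J\<^sub>s(n)\<close> has the sign \<open>(-1)\<^sup>\<omega>\<^sup>(\<^sup>n\<^sup>)\<close>. If \<open>S\<close> is factor-closed, then
  \<open>K = S\<close> is possible and the two bounds add up to \<open>n\<close>. Adding the inequalities gives
  \<open>n + i\<^sub>0 \<le> n\<close>, so \<open>i\<^sub>0 = 0\<close> and both bounds are attained.
\<close>

section \<open>The spectral theorem for Hermitian matrices\<close>

lemma mat_adjoint_dim [simp]:
  "dim_row (mat_adjoint A) = dim_col A" "dim_col (mat_adjoint A) = dim_row A"
  by (simp_all add: mat_adjoint_def mat_of_rows_def)

lemma mat_adjoint_carrier [simp]:
  "A \<in> carrier_mat nr nc \<Longrightarrow> mat_adjoint A \<in> carrier_mat nc nr"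
  by (auto intro: carrier_matI)

lemma mat_adjoint_index [simp]:
  "i < dim_col A \<Longrightarrow> j < dim_row A \<Longrightarrow> mat_adjoint A $$ (i, j) = conjugate (A $$ (j, i))"
  by (simp add: mat_adjoint_def mat_of_rows_def)

lemma mat_adjoint_mult_index:
  fixes A B :: "complex mat"
  assumes "A \<in> carrier_mat n k" "B \<in> carrier_mat n l" "i < k" "j < l"
  shows "(mat_adjoint A * B) $$ (i, j) = (\<Sum>a<n. cnj (A $$ (a, i)) * B $$ (a, j))"
  using assms by (auto simp: scalar_prod_def lessThan_atLeast0 intro!: sum.cong)

lemma mat_adjoint_mat_adjoint [simp]:
  "mat_adjoint (mat_adjoint (A :: complex mat)) = A"
  by (rule eq_matI) auto

lemma mat_adjoint_mult:
  fixes A B :: "complex mat"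
  assumes A: "A \<in> carrier_mat n k" and B: "B \<in> carrier_mat k l"
  shows "mat_adjoint (A * B) = mat_adjoint B * mat_adjoint A"
proof (rule eq_matI)
  have AB: "A * B \<in> carrier_mat n l" using A B by simp
  show "dim_row (mat_adjoint (A * B)) = dim_row (mat_adjoint B * mat_adjoint A)"
    "dim_col (mat_adjoint (A * B)) = dim_col (mat_adjoint B * mat_adjoint A)"
    using A B by auto
  fix i j assume "i < dim_row (mat_adjoint B * mat_adjoint A)" "j < dim_col (mat_adjoint B * mat_adjoint A)"
  hence i: "i < l" and j: "j < n" using A B by auto
  have "(mat_adjoint B * mat_adjoint A) $$ (i, j)
      = (\<Sum>a<k. cnj (B $$ (a, i)) * mat_adjoint A $$ (a, j))"
    by (rule mat_adjoint_mult_index[OF B mat_adjoint_carrier[OF A] i j])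
  also have "\<dots> = cnj ((A * B) $$ (j, i))"
    using A B i j by (auto simp: scalar_prod_def lessThan_atLeast0
        intro!: sum.cong)
  finally show "mat_adjoint (A * B) $$ (i, j) = (mat_adjoint B * mat_adjoint A) $$ (i, j)"
    using i j A B by simp
qed

text \<open>Gram-Schmidt applied to a basis that starts with \<open>v\<close> leaves \<open>v\<close> in place and gives pairwise
  orthogonal, nonzero columns; they only have to be scaled to length \<open>1\<close>. The scaling is essential for
  the deflation step below: with a merely orthogonal \<open>W\<close> the matrix \<open>W\<^sup>-\<^sup>1 A W\<close> need not be Hermitian.\<close>

lemma unitary_completion:
  fixes v :: "complex vec"
  assumes v: "v \<in> carrier_vec n" and v0: "v \<noteq> 0\<^sub>v n"
  obtains W c where "W \<in> carrier_mat n n" "mat_adjoint W * W = 1\<^sub>m n" "col W 0 = c \<cdot>\<^sub>v v"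
proof -
  interpret cof_vec_space n "TYPE(complex)" .
  define b where "b = basis_completion v"
  define ws where "ws = gram_schmidt n b"
  note bc = basis_completion[OF v v0, folded b_def]
  have n: "0 < n" using v v0 by (cases n) auto
  obtain vs where bv: "b = v # vs" using bc(6,7) n by (cases b) auto
  have ws: "corthogonal ws" "set ws \<subseteq> carrier_vec n" "length ws = n"
    using gram_schmidt_result[OF bc(2,4,5) refl, folded ws_def] bc(6) by auto
  have "hd ws = v" using gram_schmidt_hd[OF v, of vs, folded bv] by (simp add: ws_def)
  hence ws0: "ws ! 0 = v" using ws(3) n by (cases ws) auto
  have car: "ws ! i \<in> carrier_vec n" if "i < n" for i using ws that by auto
  define r where "r i = complex_of_real (1 / sqrt (Re (ws ! i \<bullet>c ws ! i)))" for i
  define W where "W = mat n n (\<lambda>(a, i). r i * ws ! i $ a)"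
  have W: "W \<in> carrier_mat n n" by (simp add: W_def)
  have "(\<Sum>a<n. cnj (W $$ (a, i)) * W $$ (a, j)) = (if i = j then 1 else 0)" if ij: "i < n" "j < n" for i j
  proof -
    have "(\<Sum>a<n. cnj (W $$ (a, i)) * W $$ (a, j)) = r i * r j * (ws ! j \<bullet>c ws ! i)"
      using ij car[OF ij(1)] car[OF ij(2)]
      by (auto simp: W_def scalar_prod_def r_def sum_distrib_left lessThan_atLeast0 intro!: sum.cong)
    also have "\<dots> = (if i = j then 1 else 0)"
    proof (cases "i = j")
      case False
      thus ?thesis using corthogonalD[OF ws(1), of j i] ws(3) ij by auto
    next
      case True
      let ?q = "ws ! i \<bullet>c ws ! i"
      have "?q \<noteq> 0" using corthogonalD[OF ws(1), of i i] ws(3) ij by auto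
      moreover have "?q \<ge> 0" by (auto simp: scalar_prod_def less_eq_complex_def intro!: sum_nonneg add_nonneg_nonneg)
      ultimately have q: "Re ?q > 0" "Im ?q = 0" by (auto simp: less_eq_complex_def complex_eq_iff)
      hence "?q = complex_of_real (Re ?q)" by (simp add: complex_eq_iff)
      hence "r i * r i * ?q = complex_of_real (1 / sqrt (Re ?q) * (1 / sqrt (Re ?q)) * Re ?q)"
        unfolding r_def by (metis of_real_mult)
      also have "\<dots> = 1" using q by (simp add: field_simps)
      finally show ?thesis using True by simp
    qed
    finally show ?thesis .
  qed
  hence "mat_adjoint W * W = 1\<^sub>m n"
    using W mat_adjoint_carrier[OF W]
    by (intro eq_matI) (simp_all add: mat_adjoint_mult_index[OF W W] del: index_mult_mat(1))
  moreover have "col W 0 = r 0 \<cdot>\<^sub>v v"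
    using n v by (intro eq_vecI) (auto simp: W_def ws0)
  ultimately show ?thesis using W that by blast
qed

text \<open>The spectral theorem, by deflation: in an orthonormal basis that starts with an eigenvector the
  first column of \<open>A\<close> vanishes off the diagonal, by Hermitian symmetry so does the first row, and the
  remaining block is again Hermitian.\<close>

theorem hermitian_unitarily_diagonalizable:
  fixes A :: "complex mat"
  assumes "A \<in> carrier_mat n n" "mat_adjoint A = A"
  shows "\<exists>P d. P \<in> carrier_mat n n \<and> mat_adjoint P * P = 1\<^sub>m n \<and>
    mat_adjoint P * A * P = mat n n (\<lambda>(i, j). if i = j then complex_of_real (d i) else 0)"
  using assms
proof (induction n arbitrary: A)
  case 0
  thus ?case by (intro exI[of _ "1\<^sub>m 0"] exI[of _ "\<lambda>_. 0"]) (auto intro!: eq_matI)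
next
  case (Suc n A)
  note A = Suc.prems(1)
  obtain es where es: "char_poly A = (\<Prod>a\<leftarrow>es. [:- a, 1:])" "length es = Suc n"
    using char_poly_factorized[OF A] by blast
  then obtain e where "eigenvalue A e"
    using eigenvalue_root_char_poly[OF A] by (cases es) auto
  then obtain v where v: "v \<in> carrier_vec (Suc n)" "v \<noteq> 0\<^sub>v (Suc n)" "A *\<^sub>v v = e \<cdot>\<^sub>v v"
    using A unfolding eigenvalue_def eigenvector_def by auto
  obtain W c where W: "W \<in> carrier_mat (Suc n) (Suc n)" and WW: "mat_adjoint W * W = 1\<^sub>m (Suc n)"
    and col: "col W 0 = c \<cdot>\<^sub>v v"
    using unitary_completion[OF v(1,2)] by blast
  note W' = mat_adjoint_carrier[OF W]
  define B where "B = mat_adjoint W * A * W"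
  have B: "B \<in> carrier_mat (Suc n) (Suc n)" using A W W' by (auto simp: B_def)
  have Bherm: "mat_adjoint B = B"
    unfolding B_def mat_adjoint_mult[OF mult_carrier_mat[OF W' A] W] mat_adjoint_mult[OF W' A]
    using assoc_mult_mat[OF W' A W] Suc.prems(2) by simp
  have Bcnj: "B $$ (i, j) = cnj (B $$ (j, i))" if "i < Suc n" "j < Suc n" for i j
    using mat_adjoint_index[of i B j] that B Bherm by simp
  have col_AW: "col (A * W) 0 = e \<cdot>\<^sub>v col W 0"
  proof -
    have "col (A * W) 0 = A *\<^sub>v (c \<cdot>\<^sub>v v)" using col_mult2[OF A W, of 0] col by simp
    also have "\<dots> = c \<cdot>\<^sub>v (e \<cdot>\<^sub>v v)" using mult_mat_vec[OF A v(1)] v(3) by simp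
    finally show ?thesis by (simp only: col smult_smult_assoc mult.commute)
  qed
  have AW: "(A * W) $$ (a, 0) = e * W $$ (a, 0)" if "a < Suc n" for a
  proof -
    have "(A * W) $$ (a, 0) = col (A * W) 0 $ a" using that A W by simp
    also have "\<dots> = e * W $$ (a, 0)" unfolding col_AW using that W by simp
    finally show ?thesis .
  qed
  have B0: "B $$ (i, 0) = (if i = 0 then e else 0)" if "i < Suc n" for i
  proof -
    have "B $$ (i, 0) = (mat_adjoint W * (A * W)) $$ (i, 0)"
      unfolding B_def assoc_mult_mat[OF W' A W] ..
    also have "\<dots> = e * (mat_adjoint W * W) $$ (i, 0)"
      using that A W
      by (simp add: mat_adjoint_mult_index[OF W W] mat_adjoint_mult_index[OF W mult_carrier_mat[OF A W]]
         AW sum_distrib_left algebra_simps del: index_mult_mat(1) lessThan_Suc sum.lessThan_Suc)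
    finally show ?thesis using that by (simp add: WW)
  qed
  \<comment> \<open>The eigenvalue \<open>e\<close> is a diagonal entry of the Hermitian matrix \<open>B\<close>, hence real.\<close>
  have e: "e = complex_of_real (Re e)"
    using Bcnj[of 0 0] B0[of 0] by (simp add: complex_eq_iff)
  define C where "C = mat n n (\<lambda>(i, j). B $$ (Suc i, Suc j))"
  have C: "C \<in> carrier_mat n n" by (simp add: C_def)
  have Beq: "B = four_block_mat (mat 1 1 (\<lambda>_. e)) (0\<^sub>m 1 n) (0\<^sub>m n 1) C"
  proof (rule eq_matI)
    fix i j assume "i < dim_row (four_block_mat (mat 1 1 (\<lambda>_. e)) (0\<^sub>m 1 n) (0\<^sub>m n 1) C)"
      "j < dim_col (four_block_mat (mat 1 1 (\<lambda>_. e)) (0\<^sub>m 1 n) (0\<^sub>m n 1) C)"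
    hence "i < Suc n" "j < Suc n" using C by auto
    thus "B $$ (i, j) = four_block_mat (mat 1 1 (\<lambda>_. e)) (0\<^sub>m 1 n) (0\<^sub>m n 1) C $$ (i, j)"
      using B0[of i] B0[of j] Bcnj[of i j] C by (auto simp: C_def)
  qed (use B C in auto)
  have "mat_adjoint C = C"
  proof (rule eq_matI)
    fix i j assume "i < dim_row C" "j < dim_col C"
    thus "mat_adjoint C $$ (i, j) = C $$ (i, j)"
      using C Bcnj[of "Suc i" "Suc j"] by (simp add: C_def)
  qed (use C in auto)
  then obtain P d where P: "P \<in> carrier_mat n n" and PP: "mat_adjoint P * P = 1\<^sub>m n"
    and PCP: "mat_adjoint P * C * P = mat n n (\<lambda>(i, j). if i = j then complex_of_real (d i) else 0)"
    using Suc.IH[OF C] by blast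
  note P' = mat_adjoint_carrier[OF P]
  define F where "F = four_block_mat (1\<^sub>m 1) (0\<^sub>m 1 n) (0\<^sub>m n 1) P"
  have F: "F \<in> carrier_mat (Suc n) (Suc n)" using P by (auto simp: F_def)
  note F' = mat_adjoint_carrier[OF F]
  have F'eq: "mat_adjoint F = four_block_mat (1\<^sub>m 1) (0\<^sub>m 1 n) (0\<^sub>m n 1) (mat_adjoint P)"
    using F F' P P' by (intro eq_matI) (auto simp: F_def)
  have block: "four_block_mat U (0\<^sub>m 1 n) (0\<^sub>m n 1) X * four_block_mat V (0\<^sub>m 1 n) (0\<^sub>m n 1) Y
      = four_block_mat (U * V) (0\<^sub>m 1 n) (0\<^sub>m n 1) (X * Y)"
    if "U \<in> carrier_mat 1 1" "V \<in> carrier_mat 1 1" "X \<in> carrier_mat n n" "Y \<in> carrier_mat n n"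
    for U V X Y :: "complex mat"
  proof -
    have "four_block_mat U (0\<^sub>m 1 n) (0\<^sub>m n 1) X * four_block_mat V (0\<^sub>m 1 n) (0\<^sub>m n 1) Y
      = four_block_mat (U * V + 0\<^sub>m 1 n * 0\<^sub>m n 1) (U * 0\<^sub>m 1 n + 0\<^sub>m 1 n * Y)
          (0\<^sub>m n 1 * V + X * 0\<^sub>m n 1) (0\<^sub>m n 1 * 0\<^sub>m 1 n + X * Y)"
      by (rule mult_four_block_mat) (use that in auto)
    thus ?thesis using that mult_carrier_mat[OF that(1,2)] mult_carrier_mat[OF that(3,4)] by simp
  qed
  have FF: "mat_adjoint F * F = 1\<^sub>m (Suc n)"
    unfolding F'eq unfolding F_def by (subst block) (use P P' PP in auto)
  have "mat_adjoint F * B = four_block_mat (mat 1 1 (\<lambda>_. e)) (0\<^sub>m 1 n) (0\<^sub>m n 1) (mat_adjoint P * C)"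
    unfolding F'eq Beq by (subst block) (use P' C in auto)
  hence FBF: "mat_adjoint F * B * F = four_block_mat (mat 1 1 (\<lambda>_. e)) (0\<^sub>m 1 n) (0\<^sub>m n 1)
      (mat_adjoint P * C * P)"
    unfolding F_def by (simp only:) (subst block; use P P' C in auto)
  have WF: "mat_adjoint (W * F) = mat_adjoint F * mat_adjoint W" by (rule mat_adjoint_mult[OF W F])
  show ?case
  proof (intro exI conjI)
    show "W * F \<in> carrier_mat (Suc n) (Suc n)" using W F by simp
    have "mat_adjoint (W * F) * (W * F) = mat_adjoint F * (mat_adjoint W * W * F)"
      unfolding WF assoc_mult_mat[OF W' W F] by (rule assoc_mult_mat[OF F' W' mult_carrier_mat[OF W F]])
    also have "\<dots> = 1\<^sub>m (Suc n)" using F FF by (simp add: WW)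
    finally show "mat_adjoint (W * F) * (W * F) = 1\<^sub>m (Suc n)" .
    have W'A: "mat_adjoint W * A \<in> carrier_mat (Suc n) (Suc n)" by (rule mult_carrier_mat[OF W' A])
    have "mat_adjoint (W * F) * A * (W * F) = mat_adjoint F * (mat_adjoint W * A * (W * F))"
      unfolding WF assoc_mult_mat[OF F' W' A]
      by (rule assoc_mult_mat[OF F' W'A mult_carrier_mat[OF W F]])
    also have "\<dots> = mat_adjoint F * B * F"
      unfolding assoc_mult_mat[OF W'A W F, symmetric] B_def[symmetric]
      by (rule assoc_mult_mat[OF F' B F, symmetric])
    also have "\<dots> = mat (Suc n) (Suc n) (\<lambda>(i, j). if i = j then complex_of_real (case_nat (Re e) d i) else 0)"
      unfolding FBF PCP using e by (intro eq_matI) (auto split: nat.split)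
    finally show "mat_adjoint (W * F) * A * (W * F) = \<dots>" .
  qed
qed

section \<open>Inertia of a weighted sum of squares\<close>

text \<open>Gaussian elimination, one equation at a time: an equation with a nonzero coefficient at \<open>j\<close> is
  solved for the unknown \<open>j\<close>, which removes one equation and one unknown.\<close>

lemma homogeneous_system_nontrivial_solution:
  fixes c :: "'k \<Rightarrow> 'i \<Rightarrow> 'a :: field"
  assumes "finite K" "finite I" "card K < card I"
  shows "\<exists>u. (\<exists>i\<in>I. u i \<noteq> 0) \<and> (\<forall>k\<in>K. (\<Sum>i\<in>I. c k i * u i) = 0)"
  using assms
proof (induction K arbitrary: I c rule: finite_induct)
  case empty
  then obtain i where "i \<in> I" by fastforce
  thus ?case by (intro exI[of _ "\<lambda>_. 1"]) auto
next
  case (insert k K I c)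
  show ?case
  proof (cases "\<forall>i\<in>I. c k i = 0")
    case True
    obtain u where "\<exists>i\<in>I. u i \<noteq> 0" "\<forall>l\<in>K. (\<Sum>i\<in>I. c l i * u i) = 0"
      using insert.IH[of I c] insert.prems insert.hyps by auto
    thus ?thesis using True by (intro exI[of _ u]) auto
  next
    case False
    then obtain j where j: "j \<in> I" "c k j \<noteq> 0" by blast
    define J where "J = I - {j}"
    have J: "finite J" "j \<notin> J" "I = insert j J" using insert.prems j by (auto simp: J_def)
    define c' where "c' l i = c l i - c l j * c k i / c k j" for l i
    have "card K < card J" using insert.prems insert.hyps J by auto
    then obtain u where u: "\<exists>i\<in>J. u i \<noteq> 0" "\<forall>l\<in>K. (\<Sum>i\<in>J. c' l i * u i) = 0"
      using insert.IH[of J c'] J(1) by blast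
    define r where "r = - (\<Sum>i\<in>J. c k i * u i) / c k j"
    define u' where "u' = u(j := r)"
    have sum: "(\<Sum>i\<in>I. c l i * u' i) = c l j * r + (\<Sum>i\<in>J. c l i * u i)" for l
    proof -
      have "(\<Sum>i\<in>J. c l i * u' i) = (\<Sum>i\<in>J. c l i * u i)"
        using J(2) by (intro sum.cong) (auto simp: u'_def)
      thus ?thesis using J by (simp add: u'_def)
    qed
    have "(\<Sum>i\<in>I. c k i * u' i) = 0" using j(2) by (simp add: sum r_def)
    moreover have "(\<Sum>i\<in>I. c l i * u' i) = 0" if "l \<in> K" for l
    proof -
      have "(\<Sum>i\<in>J. c' l i * u i) = (\<Sum>i\<in>J. c l i * u i) - c l j / c k j * (\<Sum>i\<in>J. c k i * u i)"
        by (simp add: c'_def left_diff_distrib right_diff_distrib sum_subtractf sum_distrib_left sum_divide_distrib mult_ac)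
      hence "(\<Sum>i\<in>J. c l i * u i) = c l j / c k j * (\<Sum>i\<in>J. c k i * u i)" using u(2) that by simp
      thus ?thesis by (simp add: sum r_def)
    qed
    moreover have "\<exists>i\<in>I. u' i \<noteq> 0" using u(1) J by (auto simp: u'_def)
    ultimately show ?thesis by (intro exI[of _ u']) auto
  qed
qed

lemma order_prod_linear_factors:
  fixes d :: "'b \<Rightarrow> 'a :: idom"
  assumes "finite I"
  shows "Polynomial.order t (\<Prod>i\<in>I. [:- d i, 1:]) = card {i \<in> I. d i = t}"
  using assms
proof (induction I rule: finite_induct)
  case empty
  thus ?case by (simp add: order_0I)
next
  case (insert j I)
  have "[:- d j, 1:] * (\<Prod>i\<in>I. [:- d i, 1:]) \<noteq> 0"
    using insert.hyps by (simp only: mult_eq_0_iff prod_zero_iff) simp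
  hence "Polynomial.order t (\<Prod>i\<in>insert j I. [:- d i, 1:]) = Polynomial.order t [:- d j, 1:] + card {i \<in> I. d i = t}"
    unfolding prod.insert[OF insert.hyps] by (subst Polynomial.order_mult) (assumption, simp only: insert.IH)
  also have "Polynomial.order t [:- d j, 1:] = (if d j = t then 1 else 0)"
    using order_power_n_n[of t 1] by (auto intro: order_0I)
  also have "\<dots> + card {i \<in> I. d i = t} = card {i \<in> insert j I. d i = t}"
  proof (cases "d j = t")
    case True
    hence "{i \<in> insert j I. d i = t} = insert j {i \<in> I. d i = t}" by auto
    thus ?thesis using insert True by simp
  next
    case False
    hence "{i \<in> insert j I. d i = t} = {i \<in> I. d i = t}" by auto
    thus ?thesis using False by simp
  qed
  finally show ?case .
qed

text \<open>Turns each of the three inertia indices into a count of diagonal entries; \<open>Q\<close> stands for being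
  positive, negative or zero.\<close>

lemma sum_order_char_poly_diagonal:
  fixes A :: "complex mat" and d :: "nat \<Rightarrow> real"
  assumes A: "A \<in> carrier_mat n n"
    and cp: "char_poly A = (\<Prod>i<n. [:- complex_of_real (d i), 1:])"
  shows "(\<Sum>t\<in>{t. eigenvalue A (complex_of_real t) \<and> Q t}. Polynomial.order (complex_of_real t) (char_poly A))
    = card {i. i < n \<and> Q (d i)}"
proof -
  have eq: "{t. eigenvalue A (complex_of_real t) \<and> Q t} = d ` {i. i < n \<and> Q (d i)}"
    unfolding eigenvalue_root_char_poly[OF A] cp by (auto simp: poly_prod)
  have "(\<Sum>t\<in>d ` {i. i < n \<and> Q (d i)}. Polynomial.order (complex_of_real t) (char_poly A))
      = (\<Sum>t\<in>d ` {i. i < n \<and> Q (d i)}. \<Sum>i | i \<in> {i. i < n \<and> Q (d i)} \<and> d i = t. 1)"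
    unfolding cp by (intro sum.cong refl) (auto simp: order_prod_linear_factors intro!: arg_cong[of _ _ card])
  also have "\<dots> = card {i. i < n \<and> Q (d i)}"
    by (subst sum.image_gen[symmetric]) auto
  finally show ?thesis unfolding eq .
qed

text \<open>The dimension argument of Sylvester's law. If there were more coordinates with \<open>d i \<ge> 0\<close> than
  indices with \<open>e k > 0\<close>, some \<open>u \<noteq> 0\<close> supported on the former would be annihilated by all linear forms
  \<open>r k\<close> with \<open>e k > 0\<close>. On this \<open>u\<close> the left-hand side is \<open>\<ge> 0\<close> and every term on the right is
  \<open>\<le> 0\<close>. Hence all the forms \<open>r k\<close> vanish at \<open>u\<close>, which forces \<open>u = 0\<close>. Counting the coordinates with
  \<open>d i = 0\<close> as well is what yields the nonsingularity of the matrices later.\<close>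

lemma card_nonneg_le_card_pos:
  fixes d :: "nat \<Rightarrow> real" and e :: "'k \<Rightarrow> real" and r :: "'k \<Rightarrow> nat \<Rightarrow> complex"
  assumes K: "finite K" and e: "\<And>k. k \<in> K \<Longrightarrow> e k \<noteq> 0"
    and form: "\<And>u. (\<Sum>i<n. d i * (cmod (u i))\<^sup>2) = (\<Sum>k\<in>K. e k * (cmod (\<Sum>i<n. r k i * u i))\<^sup>2)"
    and inj: "\<And>u i. (\<And>k. k \<in> K \<Longrightarrow> (\<Sum>i<n. r k i * u i) = 0) \<Longrightarrow> i < n \<Longrightarrow> u i = 0"
  shows "card {i. i < n \<and> d i \<ge> 0} \<le> card {k \<in> K. e k > 0}"
proof (rule ccontr)
  let ?I = "{i. i < n \<and> d i \<ge> 0}"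
  assume "\<not> ?thesis"
  then obtain v where v: "\<exists>i\<in>?I. v i \<noteq> 0" "\<forall>k\<in>{k \<in> K. e k > 0}. (\<Sum>i\<in>?I. r k i * v i) = 0"
    using homogeneous_system_nontrivial_solution[of "{k \<in> K. e k > 0}" ?I r] K by auto
  define u where "u i = (if d i \<ge> 0 then v i else 0)" for i
  have lu: "(\<Sum>i<n. r k i * u i) = (\<Sum>i\<in>?I. r k i * v i)" for k
    by (intro sum.mono_neutral_cong_right) (auto simp: u_def)
  let ?q = "\<lambda>k. - e k * (cmod (\<Sum>i<n. r k i * u i))\<^sup>2"
  have nonneg: "?q k \<ge> 0" if "k \<in> K" for k
    using that v(2) by (cases "e k > 0") (auto simp: lu mult_nonpos_nonneg)
  have "0 \<le> (\<Sum>i<n. d i * (cmod (u i))\<^sup>2)" by (intro sum_nonneg) (auto simp: u_def)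
  hence "(\<Sum>k\<in>K. ?q k) \<le> 0" by (simp add: form sum_negf)
  moreover have "(\<Sum>k\<in>K. ?q k) \<ge> 0" by (intro sum_nonneg nonneg)
  ultimately have "\<forall>k\<in>K. ?q k = 0" using sum_nonneg_eq_0_iff[OF K nonneg] by simp
  hence "\<And>k. k \<in> K \<Longrightarrow> (\<Sum>i<n. r k i * u i) = 0" using e by simp
  hence "\<And>i. i < n \<Longrightarrow> u i = 0" using inj by blast
  moreover obtain i where "i < n" "d i \<ge> 0" "v i \<noteq> 0" using v(1) by blast
  ultimately show False by (metis u_def)
qed

text \<open>If \<open>P\<close> diagonalizes \<open>A\<close> unitarily, then in the coordinates \<open>v = P u\<close> the form of \<open>A\<close> is both the
  diagonal form of the eigenvalues \<open>d\<close> and the given weighted sum of squares, with forms \<open>r k = l k \<circ> P\<close>.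
  The comparison of these two expressions gives the first bound, and the comparison of their negatives
  the second. There may be more squares than rows, so \<open>K\<close> may be larger than \<open>n\<close>.\<close>

theorem inertia_of_weighted_sum_of_squares:
  fixes A :: "complex mat" and e :: "'k \<Rightarrow> real" and l :: "'k \<Rightarrow> nat \<Rightarrow> complex"
  assumes A: "A \<in> carrier_mat n n" and K: "finite K" and e: "\<And>k. k \<in> K \<Longrightarrow> e k \<noteq> 0"
    and form: "\<And>i j. i < n \<Longrightarrow> j < n \<Longrightarrow>
      A $$ (i, j) = (\<Sum>k\<in>K. complex_of_real (e k) * cnj (l k i) * l k j)"
    and inj: "\<And>v i. (\<And>k. k \<in> K \<Longrightarrow> (\<Sum>i<n. l k i * v i) = 0) \<Longrightarrow> i < n \<Longrightarrow> v i = 0"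
  shows "i_pos A + i_zero A \<le> card {k \<in> K. e k > 0}"
    and "i_neg A + i_zero A \<le> card {k \<in> K. e k < 0}"
    and "i_pos A + i_neg A + i_zero A = n"
proof -
  have "mat_adjoint A = A"
    by (intro eq_matI) (use A in \<open>auto simp: form mult_ac intro!: sum.cong\<close>)
  then obtain P d where P: "P \<in> carrier_mat n n" and PP: "mat_adjoint P * P = 1\<^sub>m n"
    and D: "mat_adjoint P * A * P = mat n n (\<lambda>(i, j). if i = j then complex_of_real (d i) else 0)"
      (is "_ = ?D")
    using hermitian_unitarily_diagonalizable[OF A] by blast
  note P' = mat_adjoint_carrier[OF P]
  have PP': "P * mat_adjoint P = 1\<^sub>m n" by (rule mat_mult_left_right_inverse[OF P' P PP])
  have "similar_mat ?D A"
    by (rule similar_matI[OF _ PP PP'  D[symmetric]]) (use A P in auto)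
  hence "char_poly A = char_poly ?D" by (rule char_poly_similar[symmetric])
  also have "\<dots> = (\<Prod>a\<leftarrow>diag_mat ?D. [:- a, 1:])"
    by (rule char_poly_upper_triangular[of _ n]) auto
  also have "\<dots> = (\<Prod>i<n. [:- complex_of_real (d i), 1:])"
    by (simp add: diag_mat_def lessThan_atLeast0 prod.list_conv_set_nth)
  finally have cp: "char_poly A = (\<Prod>i<n. [:- complex_of_real (d i), 1:])" .
  note count = sum_order_char_poly_diagonal[OF A cp]
  have pos: "i_pos A = card {i. i < n \<and> d i > 0}" unfolding i_pos_def by (rule count)
  have neg: "i_neg A = card {i. i < n \<and> d i < 0}" unfolding i_neg_def by (rule count)
  have zero: "i_zero A = card {i. i < n \<and> d i = 0}" unfolding i_zero_def by (rule count)

  define r where "r k i = (\<Sum>a<n. l k a * P $$ (a, i))" for k i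
  have Pv: "(\<Sum>i<n. r k i * u i) = (\<Sum>a<n. l k a * (\<Sum>i<n. P $$ (a, i) * u i))" for k u
    unfolding r_def sum_distrib_left sum_distrib_right
    by (subst sum.swap) (simp add: mult_ac)
  \<comment> \<open>Injectivity passes from \<open>l\<close> to \<open>r\<close>, as \<open>P u = 0\<close> implies \<open>u = P\<^sup>* P u = 0\<close>.\<close>
  have rinj: "u i = 0" if r0: "\<And>k. k \<in> K \<Longrightarrow> (\<Sum>i<n. r k i * u i) = 0" and i: "i < n" for u i
  proof -
    have 0: "(\<Sum>i<n. P $$ (a, i) * u i) = 0" if "a < n" for a
      using inj[of "\<lambda>a. \<Sum>i<n. P $$ (a, i) * u i" a] r0 that by (simp add: Pv)
    have "(\<Sum>j<n. (mat_adjoint P * P) $$ (i, j) * u j)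
      = (\<Sum>j<n. \<Sum>a<n. cnj (P $$ (a, i)) * P $$ (a, j) * u j)"
      using i by (simp add: mat_adjoint_mult_index[OF P P] sum_distrib_right del: index_mult_mat(1))
    also have "\<dots> = (\<Sum>a<n. cnj (P $$ (a, i)) * (\<Sum>j<n. P $$ (a, j) * u j))"
      by (subst sum.swap) (simp add: sum_distrib_left mult_ac)
    also have "\<dots> = 0" by (simp add: 0)
    finally show ?thesis using i by (simp add: PP if_distrib if_distribR cong: if_cong)
  qed
  have AP: "(A * P) $$ (a, j) = (\<Sum>k\<in>K. complex_of_real (e k) * cnj (l k a) * r k j)"
    if "a < n" "j < n" for a j
  proof -
    have "(A * P) $$ (a, j) = (\<Sum>b<n. A $$ (a, b) * P $$ (b, j))"
      using that A P by (simp add: scalar_prod_def lessThan_atLeast0)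
    also have "\<dots> = (\<Sum>b<n. \<Sum>k\<in>K. complex_of_real (e k) * cnj (l k a) * (l k b * P $$ (b, j)))"
      using that by (intro sum.cong refl) (simp add: form sum_distrib_right mult.assoc)
    also have "\<dots> = (\<Sum>k\<in>K. complex_of_real (e k) * cnj (l k a) * r k j)"
      unfolding r_def sum_distrib_left by (rule sum.swap)
    finally show ?thesis .
  qed
  have r_cnj: "cnj (r k i) = (\<Sum>a<n. cnj (l k a) * cnj (P $$ (a, i)))" for k i
    by (simp add: r_def)
  have Dr: "(if i = j then complex_of_real (d i) else 0) = (\<Sum>k\<in>K. complex_of_real (e k) * cnj (r k i) * r k j)"
    if ij: "i < n" "j < n" for i j
  proof -
    have "(if i = j then complex_of_real (d i) else 0) = ?D $$ (i, j)" using ij by simp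
    also have "?D = mat_adjoint P * (A * P)" by (rule trans[OF D[symmetric] assoc_mult_mat[OF P' A P]])
    also have "(mat_adjoint P * (A * P)) $$ (i, j) = (\<Sum>a<n. cnj (P $$ (a, i)) * (A * P) $$ (a, j))"
      by (rule mat_adjoint_mult_index[OF P mult_carrier_mat[OF A P] ij])
    also have "\<dots> = (\<Sum>a<n. \<Sum>k\<in>K. complex_of_real (e k) * (cnj (l k a) * cnj (P $$ (a, i))) * r k j)"
      using ij by (intro sum.cong refl) (simp add: AP sum_distrib_left mult_ac del: index_mult_mat(1))
    also have "\<dots> = (\<Sum>k\<in>K. complex_of_real (e k) * cnj (r k i) * r k j)"
      by (subst sum.swap) (simp add: r_cnj sum_distrib_left sum_distrib_right)
    finally show ?thesis .
  qed
  have rform: "(\<Sum>i<n. d i * (cmod (u i))\<^sup>2) = (\<Sum>k\<in>K. e k * (cmod (\<Sum>i<n. r k i * u i))\<^sup>2)" for u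
  proof -
    have "complex_of_real (\<Sum>i<n. d i * (cmod (u i))\<^sup>2)
      = (\<Sum>i<n. \<Sum>j<n. (if i = j then complex_of_real (d i) else 0) * cnj (u i) * u j)"
      unfolding of_real_sum of_real_mult complex_norm_square
      by (simp add: mult_ac if_distrib if_distribR cong: if_cong)
    also have "\<dots> = (\<Sum>i<n. \<Sum>j<n. \<Sum>k\<in>K. complex_of_real (e k) * (cnj (r k i * u i) * (r k j * u j)))"
      by (intro sum.cong refl) (simp add: Dr sum_distrib_left sum_distrib_right mult_ac)
    also have "\<dots> = (\<Sum>i<n. \<Sum>k\<in>K. \<Sum>j<n. complex_of_real (e k) * (cnj (r k i * u i) * (r k j * u j)))"
      by (intro sum.cong refl sum.swap)
    also have "\<dots> = (\<Sum>k\<in>K. \<Sum>i<n. \<Sum>j<n. complex_of_real (e k) * (cnj (r k i * u i) * (r k j * u j)))"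
      by (rule sum.swap)
    also have "\<dots> = (\<Sum>k\<in>K. complex_of_real (e k) * (cnj (\<Sum>i<n. r k i * u i) * (\<Sum>j<n. r k j * u j)))"
      unfolding cnj_sum sum_product by (simp only: sum_distrib_left)
    also have "\<dots> = (\<Sum>k\<in>K. complex_of_real (e k * (cmod (\<Sum>i<n. r k i * u i))\<^sup>2))"
      by (intro sum.cong refl) (simp only: of_real_mult complex_norm_square mult.commute)
    also have "\<dots> = complex_of_real (\<Sum>k\<in>K. e k * (cmod (\<Sum>i<n. r k i * u i))\<^sup>2)"
      by (simp only: of_real_sum)
    finally show ?thesis by (simp only: of_real_eq_iff)
  qed

  define Z Pos Neg where "Z = {i. i < n \<and> d i = 0}"
    and "Pos = {i. i < n \<and> d i > 0}" and "Neg = {i. i < n \<and> d i < 0}"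
  have fin: "finite Z" "finite Pos" "finite Neg"
    and disj: "Pos \<inter> Z = {}" "Neg \<inter> Z = {}" "Pos \<inter> (Neg \<union> Z) = {}"
    by (auto simp: Z_def Pos_def Neg_def)
  have "card {i. i < n \<and> d i \<ge> 0} \<le> card {k \<in> K. e k > 0}"
    by (rule card_nonneg_le_card_pos[where n = n and d = d and e = e and r = r, OF K])
      (fact e rform rinj)+
  also have "{i. i < n \<and> d i \<ge> 0} = Pos \<union> Z" by (auto simp: Pos_def Z_def)
  finally show "i_pos A + i_zero A \<le> card {k \<in> K. e k > 0}"
    using card_Un_disjoint[OF fin(2,1) disj(1)] by (simp add: pos zero Pos_def Z_def)
  have "card {i. i < n \<and> - d i \<ge> 0} \<le> card {k \<in> K. - e k > 0}"
    by (rule card_nonneg_le_card_pos[where d = "\<lambda>i. - d i" and e = "\<lambda>k. - e k" and r = r and n = n, OF K])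
      (fact rinj | simp add: e rform sum_negf)+
  also have "{i. i < n \<and> - d i \<ge> 0} = Neg \<union> Z" by (auto simp: Neg_def Z_def)
  finally show "i_neg A + i_zero A \<le> card {k \<in> K. e k < 0}"
    using card_Un_disjoint[OF fin(3,1) disj(2)] by (simp add: neg zero Neg_def Z_def)
  have "card (Pos \<union> (Neg \<union> Z)) = i_pos A + i_neg A + i_zero A"
    using card_Un_disjoint[OF fin(2) _ disj(3)] card_Un_disjoint[OF fin(3,1) disj(2)] fin
    by (simp add: pos neg zero Pos_def Neg_def Z_def)
  moreover have "Pos \<union> (Neg \<union> Z) = {..<n}" by (auto simp: Pos_def Neg_def Z_def)
  ultimately show "i_pos A + i_neg A + i_zero A = n" by simp
qed

section \<open>The Jordan totient with real exponent\<close>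

text \<open>Jordan's totient function \<open>J\<^sub>s\<close>, with an arbitrary real exponent in place of a positive integer.
  As an arithmetic function it is the Dirichlet convolution of \<open>n \<mapsto> n\<^sup>s\<close> with the Moebius function. The
  product formula serves as the definition because it shows the sign.\<close>

definition jordan_totient :: "real \<Rightarrow> nat \<Rightarrow> real" where
  "jordan_totient s n = real n powr s * (\<Prod>p\<in>prime_factors n. 1 - real p powr - s)"

lemma jordan_totient_pos:
  assumes "s > 0" "n > 0"
  shows "jordan_totient s n > 0"
  unfolding jordan_totient_def
proof (intro mult_pos_pos prod_pos)
  fix p assume "p \<in> prime_factors n"
  hence "p > 1" using in_prime_factors_imp_prime prime_gt_1_nat by blast
  thus "0 < 1 - real p powr - s" using assms by (simp add: powr_less_one)
qed (use assms in auto)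

lemma prod_neg_sign:
  fixes g :: "'b \<Rightarrow> real"
  assumes "finite P" "\<And>p. p \<in> P \<Longrightarrow> g p < 0"
  shows "if even (card P) then prod g P > 0 else prod g P < 0"
  using assms by (induction P) (auto simp: mult_neg_neg mult_neg_pos mult_pos_neg mult_less_0_iff zero_less_mult_iff split: if_splits)

lemma jordan_totient_neg_exponent_sign:
  assumes "s < 0" "n > 0"
  shows "if even (omega n) then jordan_totient s n > 0 else jordan_totient s n < 0"
proof -
  have "1 - real p powr - s < 0" if "p \<in> prime_factors n" for p
  proof -
    have "p > 1" using that in_prime_factors_imp_prime prime_gt_1_nat by blast
    thus ?thesis using assms by simp
  qed
  hence "if even (card (prime_factors n)) then (\<Prod>p\<in>prime_factors n. 1 - real p powr - s) > 0
     else (\<Prod>p\<in>prime_factors n. 1 - real p powr - s) < 0"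
    by (intro prod_neg_sign) auto
  thus ?thesis using assms
    by (auto simp: omega_def jordan_totient_def mult_less_0_iff zero_less_mult_iff split: if_splits)
qed

lemma jordan_totient_prime_power_mult:
  assumes p: "prime p" and k: "k > 0" and e: "\<not> p dvd e" "e > 0"
  shows "jordan_totient s (p ^ k * e) = real (p ^ k) powr s * (1 - real p powr - s) * jordan_totient s e"
proof -
  have "prime_factors (p ^ k * e) = insert p (prime_factors e)"
    using p k e by (subst prime_factors_product) (auto simp: prime_factorization_prime_power prime_gt_0_nat)
  moreover have "p \<notin> prime_factors e" using e by auto
  ultimately show ?thesis
    by (simp add: jordan_totient_def powr_mult mult_ac)
qed

text \<open>Induction over \<open>n = p\<^sup>k\<^sup>+\<^sup>1 q\<close> with \<open>p\<close> not dividing \<open>q\<close>. A divisor of \<open>n\<close> either divides \<open>p\<^sup>k q\<close> or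
  is \<open>p\<^sup>k\<^sup>+\<^sup>1 e\<close> with \<open>e\<close> dividing \<open>q\<close>. The first kind contributes \<open>(p\<^sup>k q)\<^sup>s\<close>; on the second kind
  \<open>J\<^sub>s(p\<^sup>k\<^sup>+\<^sup>1 e) = (p\<^sup>(\<^sup>k\<^sup>+\<^sup>1\<^sup>)\<^sup>s - p\<^sup>k\<^sup>s) J\<^sub>s(e)\<close>, so it contributes \<open>(p\<^sup>(\<^sup>k\<^sup>+\<^sup>1\<^sup>)\<^sup>s - p\<^sup>k\<^sup>s) q\<^sup>s\<close>, and the terms
  with \<open>p\<^sup>k\<^sup>s\<close> cancel.\<close>

lemma sum_jordan_totient_divisors:
  "n > 0 \<Longrightarrow> (\<Sum>d | d dvd n. jordan_totient s d) = real n powr s"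
proof (induction n rule: less_induct)
  case (less n)
  show ?case
  proof (cases "n = 1")
    case True
    thus ?thesis by (simp add: jordan_totient_def)
  next
    case False
    then obtain p where p: "prime p" "p dvd n" using prime_factor_nat by blast
    obtain k q where nq: "n = p ^ Suc k * q" and q: "\<not> p dvd q"
    proof -
      obtain y where "n = p ^ multiplicity p n * y" "\<not> p dvd y"
        using multiplicity_decompose'[of n p] less.prems p not_prime_unit by blast
      moreover have "multiplicity p n \<noteq> 0" using p less.prems
        by (simp add: prime_multiplicity_gt_zero_iff) 
      ultimately show ?thesis using that by (metis not0_implies_Suc)
    qed
    have p1: "p > 1" using prime_gt_1_nat[OF p(1)] .
    have q0: "q > 0" using nq less.prems by auto
    let ?E = "(\<lambda>e. p ^ Suc k * e) ` {e. e dvd q}"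
    have split: "{d. d dvd n} = {d. d dvd p ^ k * q} \<union> ?E"
    proof (intro equalityI subsetI)
      fix d assume "d \<in> {d. d dvd n}"
      then obtain a b where ab: "d = a * b" "a dvd p ^ Suc k" "b dvd q"
        using division_decomp[of d "p ^ Suc k" q] nq by auto
      then obtain i where i: "i \<le> Suc k" "a = p ^ i"
        using divides_primepow_nat[OF p(1)] by blast
      show "d \<in> {d. d dvd p ^ k * q} \<union> ?E"
      proof (cases "i = Suc k")
        case True
        thus ?thesis using ab i by auto
      next
        case False
        hence "a dvd p ^ k" using i by (simp add: le_imp_power_dvd)
        thus ?thesis using ab by (auto intro: mult_dvd_mono)
      qed
    next
      fix d assume "d \<in> {d. d dvd p ^ k * q} \<union> ?E"
      thus "d \<in> {d. d dvd n}" by (auto simp: nq mult.assoc intro: dvd_mult)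
    qed
    have disj: "{d. d dvd p ^ k * q} \<inter> ?E = {}"
    proof -
      have False if "p ^ Suc k * e dvd p ^ k * q" for e
      proof -
        have "p * e dvd q" using that p1 by (simp add: mult.assoc mult.left_commute)
        thus False using q dvd_mult_left by blast
      qed
      thus ?thesis by blast
    qed
    have "(\<Sum>d | d dvd n. jordan_totient s d)
        = (\<Sum>d | d dvd p ^ k * q. jordan_totient s d) + (\<Sum>d\<in>?E. jordan_totient s d)"
      unfolding split using disj q0 p1 by (intro sum.union_disjoint) auto
    also have "(\<Sum>d | d dvd p ^ k * q. jordan_totient s d) = real (p ^ k * q) powr s"
      using less.IH[of "p ^ k * q"] q0 p1 nq by simp
    also have "(\<Sum>d\<in>?E. jordan_totient s d) = (\<Sum>e | e dvd q. jordan_totient s (p ^ Suc k * e))"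
      using p1 by (subst sum.reindex) (auto simp: inj_on_def)
    also have "\<dots> = (\<Sum>e | e dvd q. real (p ^ Suc k) powr s * (1 - real p powr - s) * jordan_totient s e)"
    proof (intro sum.cong refl)
      fix e assume "e \<in> {e. e dvd q}"
      hence "\<not> p dvd e" "e > 0" using q q0 by (auto dest: dvd_trans intro: dvd_pos_nat)
      thus "jordan_totient s (p ^ Suc k * e)
          = real (p ^ Suc k) powr s * (1 - real p powr - s) * jordan_totient s e"
        using jordan_totient_prime_power_mult[OF p(1)] by blast
    qed
    also have "\<dots> = real (p ^ Suc k) powr s * (1 - real p powr - s) * real q powr s"
      using less.IH[of q] q0 one_less_power[OF p1, of "Suc k"] nq by (simp add: sum_distrib_left[symmetric] del: power_Suc)
    also have "real (p ^ k * q) powr s + \<dots> = real n powr s"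
      using p1 by (simp add: nq powr_mult powr_minus field_simps)
    finally show ?thesis .
  qed
qed

section \<open>Power GCD and LCM matrices\<close>

text \<open>Triangularity of divisibility: if \<open>x\<^sub>j\<close> is the largest element with \<open>v\<^sub>j \<noteq> 0\<close>, then in the equation
  for \<open>k = x\<^sub>j\<close> every other term has \<open>v\<^sub>i = 0\<close> or \<open>x\<^sub>j\<close> not dividing \<open>x\<^sub>i\<close>, so \<open>w\<^sub>j v\<^sub>j = 0\<close>.\<close>

lemma divisor_incidence_injective:
  fixes xs :: "nat list" and w v :: "nat \<Rightarrow> 'a :: field"
  assumes "distinct xs" "\<forall>x\<in>set xs. x > 0" "set xs \<subseteq> K" "\<And>i. i < length xs \<Longrightarrow> w i \<noteq> 0"
    and sys: "\<And>k. k \<in> K \<Longrightarrow> (\<Sum>i<length xs. (if k dvd xs ! i then w i else 0) * v i) = 0"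
    and i: "i < length xs"
  shows "v i = 0"
proof (rule ccontr)
  let ?I = "{i. i < length xs \<and> v i \<noteq> 0}"
  assume "v i \<noteq> 0"
  hence "?I \<noteq> {}" using i by blast
  then obtain j where j: "j \<in> ?I" "\<And>i. i \<in> ?I \<Longrightarrow> xs ! i \<le> xs ! j"
    using arg_max_on_def Max_in[of "(!) xs ` ?I"] Max_ge[of "(!) xs ` ?I"] by fastforce
  have "(if xs ! j dvd xs ! i then w i else 0) * v i = (if i = j then w j * v j else 0)"
    if "i < length xs" for i
  proof (cases "xs ! j dvd xs ! i \<and> v i \<noteq> 0")
    case True
    have "xs ! i > 0" using assms(2) that by simp
    hence "xs ! j \<le> xs ! i" using True dvd_imp_le by blast
    moreover have "xs ! i \<le> xs ! j" using j(2) that True by blast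
    ultimately have "i = j" using assms(1) that j(1) nth_eq_iff_index_eq by fastforce
    thus ?thesis by simp
  next
    case False
    hence "i \<noteq> j" using j(1) by auto
    thus ?thesis using False by auto
  qed
  hence "(\<Sum>i<length xs. (if xs ! j dvd xs ! i then w i else 0) * v i)
    = (\<Sum>i<length xs. if i = j then w j * v j else 0)" by (intro sum.cong) auto
  also have "\<dots> = w j * v j" using j(1) by simp
  finally have "(\<Sum>i<length xs. (if xs ! j dvd xs ! i then w i else 0) * v i) = w j * v j" .
  moreover have "xs ! j \<in> K" using assms(3) j(1) by auto
  ultimately have "w j * v j = 0" using sys by simp
  thus False using assms(4) j(1) by simp
qed

text \<open>In a factor-closed set the common divisors of two elements are all the divisors of their gcd.\<close>

lemma sum_jordan_totient_factor_closed:
  assumes K: "factor_closed K" "finite K" "0 \<notin> K" and "x \<in> K" "y \<in> K"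
  shows "(\<Sum>k | k \<in> K \<and> k dvd x \<and> k dvd y. jordan_totient s k) = real (gcd x y) powr s"
proof -
  have x: "x > 0" using assms by (metis gr0I)
  have "{k \<in> K. k dvd x \<and> k dvd y} = {k. k dvd gcd x y}"
    using assms x by (auto simp: factor_closed_def intro!: Nat.gr0I)
  thus ?thesis using sum_jordan_totient_divisors[of "gcd x y" s] x by simp
qed

text \<open>The common generalization of the two matrices. The set \<open>K\<close> is separate from the list so that it can
  be the divisor closure when the elements of the list are not factor-closed.\<close>

lemma inertia_of_weighted_gcd_power_matrix:
  fixes A :: "complex mat" and w :: "nat \<Rightarrow> real"
  assumes A: "A \<in> carrier_mat (length xs) (length xs)"
    and form: "\<And>i j. i < length xs \<Longrightarrow> j < length xs \<Longrightarrow>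
      A $$ (i, j) = complex_of_real (w (xs ! i) * w (xs ! j) * real (gcd (xs ! i) (xs ! j)) powr s)"
    and w: "\<And>x. x \<in> set xs \<Longrightarrow> w x \<noteq> 0" and xs: "distinct xs" "\<forall>x\<in>set xs. x > 0"
    and K: "factor_closed K" "finite K" "0 \<notin> K" "set xs \<subseteq> K"
    and nz: "\<And>k. k \<in> K \<Longrightarrow> jordan_totient s k \<noteq> 0"
  shows "i_pos A + i_zero A \<le> card {k \<in> K. jordan_totient s k > 0}"
    and "i_neg A + i_zero A \<le> card {k \<in> K. jordan_totient s k < 0}"
    and "i_pos A + i_neg A + i_zero A = length xs"
proof -
  define l :: "nat \<Rightarrow> nat \<Rightarrow> complex" where
    "l k i = (if k dvd xs ! i then complex_of_real (w (xs ! i)) else 0)" for k i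
  have entry: "A $$ (i, j) = (\<Sum>k\<in>K. complex_of_real (jordan_totient s k) * cnj (l k i) * l k j)"
    if ij: "i < length xs" "j < length xs" for i j
  proof -
    let ?x = "xs ! i" and ?y = "xs ! j"
    have "A $$ (i, j) = complex_of_real (w ?x * w ?y * (\<Sum>k | k \<in> K \<and> k dvd ?x \<and> k dvd ?y. jordan_totient s k))"
      using form ij K sum_jordan_totient_factor_closed[OF K(1-3), of ?x ?y s] by (auto simp: subset_iff)
    also have "\<dots> = (\<Sum>k | k \<in> K \<and> k dvd ?x \<and> k dvd ?y. complex_of_real (jordan_totient s k) * cnj (l k i) * l k j)"
      by (simp add: l_def sum_distrib_left mult_ac)
    also have "\<dots> = (\<Sum>k\<in>K. complex_of_real (jordan_totient s k) * cnj (l k i) * l k j)"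
      using K(2) by (intro sum.mono_neutral_left) (auto simp: l_def)
    finally show ?thesis .
  qed
  have inj: "v i = 0" if "\<And>k. k \<in> K \<Longrightarrow> (\<Sum>i<length xs. l k i * v i) = 0" "i < length xs" for v i
    using divisor_incidence_injective[OF xs K(4), of "\<lambda>i. complex_of_real (w (xs ! i))" v i] w that
    by (simp add: l_def)
  note inertia = inertia_of_weighted_sum_of_squares[where e = "jordan_totient s" and l = l, OF A K(2)]
  show "i_pos A + i_zero A \<le> card {k \<in> K. jordan_totient s k > 0}"
    "i_neg A + i_zero A \<le> card {k \<in> K. jordan_totient s k < 0}"
    "i_pos A + i_neg A + i_zero A = length xs" by (rule inertia; fact nz entry inj)+
qed

theorem theorem4p1:
  fixes m :: real and f :: "nat \<Rightarrow> complex" and n :: nat and xs :: "nat list"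
  assumes "m > 0"
    and "\<And>x. x > 0 \<Longrightarrow> f x = complex_of_real (real x powr m)"
    and "length xs = n" and "distinct xs" and "\<forall>x\<in>set xs. x > 0"
  shows "(i_pos (gcd_matrix f xs) = n \<and>
          i_neg (gcd_matrix f xs) = 0 \<and>
          i_zero (gcd_matrix f xs) = 0) \<and>
         (factor_closed (set xs) \<longrightarrow>
          i_pos (lcm_matrix f xs) = card {x \<in> set xs. even (omega x)} \<and>
          i_neg (lcm_matrix f xs) = card {x \<in> set xs. odd (omega x)} \<and>
          i_zero (lcm_matrix f xs) = 0)"
proof (intro conjI impI)
  note m = assms(1) and f = assms(2) and len = assms(3) and dist = assms(4) and pos = assms(5)
  have ipos: "xs ! i > 0" if "i < length xs" for i using pos that by simp

  \<comment> \<open>The GCD matrix: all weights on the divisor closure are positive.\<close>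
  define K where "K = {d. \<exists>x\<in>set xs. d dvd x}"
  have fin: "finite K"
  proof -
    have "K = (\<Union>x\<in>set xs. {d. d dvd x})" by (auto simp: K_def)
    thus ?thesis using pos by auto
  qed
  have K: "factor_closed K" "0 \<notin> K" "set xs \<subseteq> K"
  proof -
    show "factor_closed K" unfolding K_def factor_closed_def by (blast intro: dvd_trans)
    show "0 \<notin> K" using pos by (auto simp: K_def)
    show "set xs \<subseteq> K"
    proof
      fix x assume "x \<in> set xs"
      hence "\<exists>y\<in>set xs. x dvd y" by (rule bexI[rotated]) (rule dvd_refl)
      thus "x \<in> K" by (simp add: K_def)
    qed
  qed
  have Jpos: "jordan_totient m k > 0" if "k \<in> K" for k
    using jordan_totient_pos[OF m] that K(2) by (metis gr0I)
  let ?G = "gcd_matrix f xs"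
  have G: "?G \<in> carrier_mat (length xs) (length xs)" by (simp add: gcd_matrix_def)
  have G_entry: "?G $$ (i, j) = complex_of_real (1 * 1 * real (gcd (xs ! i) (xs ! j)) powr m)"
    if "i < length xs" "j < length xs" for i j
    using that ipos[of i] by (simp add: gcd_matrix_def f)
  have J_nz: "jordan_totient m k \<noteq> 0" if "k \<in> K" for k using Jpos[OF that] by simp
  note gcd = inertia_of_weighted_gcd_power_matrix[where w = "\<lambda>_. 1",
      OF G G_entry one_neq_zero dist pos K(1) fin K(2,3) J_nz]
  have no_neg: "{k \<in> K. jordan_totient m k < 0} = {}" using Jpos by (auto simp: not_less less_imp_le)
  show g: "i_neg ?G = 0" "i_zero ?G = 0" using gcd(2) unfolding no_neg by simp_all
  show "i_pos ?G = n" using gcd(3) g len by simp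

  \<comment> \<open>The LCM matrix: the numbers of positive and of negative weights add up to \<open>n\<close>.\<close>
  assume fc: "factor_closed (set xs)"
  have sign: "jordan_totient (- m) x > 0 \<longleftrightarrow> even (omega x)"
    "jordan_totient (- m) x < 0 \<longleftrightarrow> odd (omega x)" if "x \<in> set xs" for x
    using jordan_totient_neg_exponent_sign[of "- m" x] m pos that by (auto split: if_splits)
  have lcm_entry: "f (lcm x y) = complex_of_real (real x powr m * real y powr m * real (gcd x y) powr - m)"
    if "x > 0" "y > 0" for x y
  proof -
    have "real (lcm x y) * real (gcd x y) = real x * real y"
      by (metis mult.commute of_nat_mult prod_gcd_lcm_nat)
    hence "real (lcm x y) powr m * real (gcd x y) powr m = real x powr m * real y powr m"
      by (metis powr_mult of_nat_0_le_iff)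
    hence "real (lcm x y) powr m = real x powr m * real y powr m * real (gcd x y) powr - m"
      using that by (simp add: powr_minus field_simps)
    thus ?thesis using f[of "lcm x y"] that by (simp add: lcm_pos_nat)
  qed
  let ?L = "lcm_matrix f xs"
  have L: "?L \<in> carrier_mat (length xs) (length xs)" by (simp add: lcm_matrix_def)
  have L_entry: "?L $$ (i, j) = complex_of_real (real (xs ! i) powr m * real (xs ! j) powr m
      * real (gcd (xs ! i) (xs ! j)) powr - m)"
    if "i < length xs" "j < length xs" for i j
    using that lcm_entry[OF ipos ipos] by (simp add: lcm_matrix_def)
  have w_nz: "real x powr m \<noteq> 0" if "x \<in> set xs" for x using pos that by simp
  have J_nz': "jordan_totient (- m) k \<noteq> 0" if "k \<in> set xs" for k
    using sign[OF that] by auto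
  have "0 \<notin> set xs" using pos by blast
  note lcm = inertia_of_weighted_gcd_power_matrix[where w = "\<lambda>x. real x powr m",
      OF L L_entry w_nz dist pos fc finite_set \<open>0 \<notin> set xs\<close> subset_refl J_nz']
  have pos_weights: "{k \<in> set xs. jordan_totient (- m) k > 0} = {x \<in> set xs. even (omega x)}"
    and neg_weights: "{k \<in> set xs. jordan_totient (- m) k < 0} = {x \<in> set xs. odd (omega x)}"
    using sign by auto
  have "card {x \<in> set xs. even (omega x)} + card {x \<in> set xs. odd (omega x)} = length xs"
  proof -
    have "card ({x \<in> set xs. even (omega x)} \<union> {x \<in> set xs. odd (omega x)})
      = card {x \<in> set xs. even (omega x)} + card {x \<in> set xs. odd (omega x)}"
      by (rule card_Un_disjoint) auto
    moreover have "{x \<in> set xs. even (omega x)} \<union> {x \<in> set xs. odd (omega x)} = set xs" by auto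
    ultimately show ?thesis using distinct_card[OF dist] by simp
  qed
  thus "i_pos ?L = card {x \<in> set xs. even (omega x)}"
    "i_neg ?L = card {x \<in> set xs. odd (omega x)}" "i_zero ?L = 0" using lcm unfolding pos_weights neg_weights by linarith+
qed

end
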